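(* Let $G$ be a topological group and let $p\colon E\to B$ be a $G$-fibration. 1. If $G$ acts trivially on $E$ and $B$, then $\mathrm{TC}^{G}[p\colon E\to B]=\mathrm{TC}[p\colon E\to B]$. 2. If $B=\{*\}$ is a point, then $\mathrm{TC}^{G}[p\colon E\to\{*\}]=\mathrm{TC}^{G}(E)$.
   Context: All spaces are Hausdorff, $I=[0,1]$, path spaces carry the compact-open topology. A $G$-map is a continuous equivariant map; a $G$-homotopy is an equivariant homotopy ($G$ acting trivially on $I$). A $G$-fibration is a $G$-map with the $G$-homotopy lifting property with respect to every $G$-space. Equivariant sectional category: for a $G$-map $q\colon X\to Y$, $\mathrm{secat}_G(q)$ is the least positive integer $k$ such that $Y$ has a cover by $G$-invariant open sets $U_1,\dots,U_k$ with $G$-maps $s_i\colon U_i\to X$ such that $q\circ s_i$ is $G$-homotopic to the inclusion $U_i\hookrightarrow Y$ ($\infty$ if there is no such $k$). Invariant parametrized topological complexity: for a $G$-fibration $p\colon E\to B$, let $E^I_B$ be the space of paths $\gamma\colon I\to E$ whose image lies in a single fibre of $p$, with $(g\cdot\gamma)(t)=g\cdot\gamma(t)$. Put $E^I_B\times_{E/G}E^I_B=\{(\gamma,\delta)\in E^I_B\times E^I_B : G\cdot\gamma(1)=G\cdot\delta(0)\}$ and $E\times_{B/G}E=\{(e_1,e_2)\in E\times E : G\cdot p(e_1)=G\cdot p(e_2)\}$, with the componentwise $(G\times G)$-actions, and let $\Psi(\gamma,\delta)=(\gamma(0),\delta(1))$, a $(G\times G)$-fibration $E^I_B\times_{E/G}E^I_B\to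 E\times_{B/G}E$. Then $\mathrm{TC}^G[p\colon E\to B]:=\mathrm{secat}_{G\times G}(\Psi)$. Parametrized topological complexity: for a fibration $p\colon E\to B$, $\mathrm{TC}[p\colon E\to B]$ is the least positive integer $k$ such that $E\times_B E=\{(e_1,e_2): p(e_1)=p(e_2)\}$ has an open cover $U_1,\dots,U_k$ on each member of which the fibration $\Pi\colon E^I_B\to E\times_B E$, $\Pi(\gamma)=(\gamma(0),\gamma(1))$, admits a continuous section. Invariant topological complexity: for a $G$-space $X$ with free path space $PX=X^I$, let $PX\times_{X/G}PX=\{(\gamma,\delta)\in PX\times PX: G\cdot\gamma(1)=G\cdot\delta(0)\}$ and $\mathfrak{p}\colon PX\times_{X/G}PX\to X\times X$, $\mathfrak{p}(\gamma,\delta)=(\gamma(0),\delta(1))$, which is a $(G\times G)$-fibration for the componentwise actions; $\mathrm{TC}^G(X):=\mathrm{secat}_{G\times G}(\mathfrak{p})$. *)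

theory Defs
  imports "HOL-Analysis.Analysis" "HOL-Algebra.Group_Action"
begin

section \<open>Topological groups, G-spaces and G-maps\<close>

definition topological_group :: "('g, 'm) monoid_scheme \<Rightarrow> 'g topology \<Rightarrow> bool" where
  "topological_group G T \<longleftrightarrow>
     group G \<and> topspace T = carrier G \<and> Hausdorff_space T \<and>
     continuous_map (prod_topology T T) T (\<lambda>(g, h). g \<otimes>\<^bsub>G\<^esub> h) \<and>
     continuous_map T T (\<lambda>g. inv\<^bsub>G\<^esub> g)"

definition G_space ::
  "('g, 'm) monoid_scheme \<Rightarrow> 'g topology \<Rightarrow> 'a topology \<Rightarrow> ('g \<Rightarrow> 'a \<Rightarrow> 'a) \<Rightarrow> bool" where
  "G_space G T X \<phi> \<longleftrightarrow>
     Hausdorff_space X \<and> group_action G (topspace X) \<phi> \<and>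
     continuous_map (prod_topology T X) X (\<lambda>(g, x). \<phi> g x)"

definition equivariant_on ::
  "('g, 'm) monoid_scheme \<Rightarrow> 'a set \<Rightarrow> ('g \<Rightarrow> 'a \<Rightarrow> 'a) \<Rightarrow> ('g \<Rightarrow> 'b \<Rightarrow> 'b) \<Rightarrow> ('a \<Rightarrow> 'b) \<Rightarrow> bool" where
  "equivariant_on G S \<phi> \<psi> f \<longleftrightarrow> (\<forall>g\<in>carrier G. \<forall>x\<in>S. f (\<phi> g x) = \<psi> g (f x))"

definition G_map ::
  "('g, 'm) monoid_scheme \<Rightarrow> 'a topology \<Rightarrow> ('g \<Rightarrow> 'a \<Rightarrow> 'a) \<Rightarrow> 'b topology \<Rightarrow> ('g \<Rightarrow> 'b \<Rightarrow> 'b)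
     \<Rightarrow> ('a \<Rightarrow> 'b) \<Rightarrow> bool" where
  "G_map G X \<phi> Y \<psi> f \<longleftrightarrow> continuous_map X Y f \<and> equivariant_on G (topspace X) \<phi> \<psi> f"

definition trivial_action ::
  "('g, 'm) monoid_scheme \<Rightarrow> 'a topology \<Rightarrow> ('g \<Rightarrow> 'a \<Rightarrow> 'a) \<Rightarrow> bool" where
  "trivial_action G X \<phi> \<longleftrightarrow> (\<forall>g\<in>carrier G. \<forall>x\<in>topspace X. \<phi> g x = x)"

text \<open>A homotopy \<open>h\<close> on \<open>I \<times> X\<close>, with \<open>G\<close> acting trivially on \<open>I\<close>, is equivariant
  precisely if every stage \<open>h (t, -)\<close> is; so G-homotopy is an instance of
  \<^const>\<open>homotopic_with\<close>.\<close>

definition G_homotopic ::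
  "('g, 'm) monoid_scheme \<Rightarrow> 'a topology \<Rightarrow> ('g \<Rightarrow> 'a \<Rightarrow> 'a) \<Rightarrow> 'b topology \<Rightarrow> ('g \<Rightarrow> 'b \<Rightarrow> 'b)
     \<Rightarrow> ('a \<Rightarrow> 'b) \<Rightarrow> ('a \<Rightarrow> 'b) \<Rightarrow> bool" where
  "G_homotopic G X \<phi> Y \<psi> = homotopic_with (equivariant_on G (topspace X) \<phi> \<psi>) X Y"


section \<open>Path spaces\<close>

text \<open>Maps are represented by functions that are \<^const>\<open>undefined\<close> outside the domain, so
  that distinct points of the space are distinct maps.\<close>

definition compact_open :: "'a topology \<Rightarrow> 'b topology \<Rightarrow> ('a \<Rightarrow> 'b) topology" where
  "compact_open X Y =
     subtopology (topology_generated_by {{f. f ` K \<subseteq> U} | K U. compactin X K \<and> openin Y U})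
       {f \<in> extensional (topspace X). continuous_map X Y f}"

definition path_space :: "'a topology \<Rightarrow> (real \<Rightarrow> 'a) topology" where
  "path_space X = compact_open (top_of_set {0..1}) X"

definition path_action :: "('g \<Rightarrow> 'a \<Rightarrow> 'a) \<Rightarrow> 'g \<Rightarrow> (real \<Rightarrow> 'a) \<Rightarrow> real \<Rightarrow> 'a" where
  "path_action \<phi> g \<gamma> = (\<lambda>t\<in>{0..1}. \<phi> g (\<gamma> t))"

definition fibre_path_space :: "'e topology \<Rightarrow> 'b topology \<Rightarrow> ('e \<Rightarrow> 'b) \<Rightarrow> (real \<Rightarrow> 'e) topology" where
  "fibre_path_space E B p =
     subtopology (path_space E) {\<gamma>. \<exists>b\<in>topspace B. \<forall>t\<in>{0..1}. p (\<gamma> t) = b}"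


section \<open>G-fibrations\<close>

definition G_homotopy_lifting ::
  "('g, 'm) monoid_scheme \<Rightarrow> 'e topology \<Rightarrow> ('g \<Rightarrow> 'e \<Rightarrow> 'e) \<Rightarrow> 'b topology \<Rightarrow> ('g \<Rightarrow> 'b \<Rightarrow> 'b)
     \<Rightarrow> ('e \<Rightarrow> 'b) \<Rightarrow> 'z topology \<Rightarrow> ('g \<Rightarrow> 'z \<Rightarrow> 'z) \<Rightarrow> bool" where
  "G_homotopy_lifting G E \<phi> B \<psi> p Z \<zeta> \<longleftrightarrow>
     (\<forall>f h. G_map G Z \<zeta> E \<phi> f \<and>
        continuous_map (prod_topology (top_of_set {0..1}) Z) B h \<and>
        (\<forall>t\<in>{0..1}. equivariant_on G (topspace Z) \<zeta> \<psi> (\<lambda>z. h (t, z))) \<and>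
        (\<forall>z\<in>topspace Z. h (0, z) = p (f z)) \<longrightarrow>
        (\<exists>k. continuous_map (prod_topology (top_of_set {0..1::real}) Z) E k \<and>
           (\<forall>t\<in>{0..1}. equivariant_on G (topspace Z) \<zeta> \<phi> (\<lambda>z. k (t, z))) \<and>
           (\<forall>t\<in>{0..1}. \<forall>z\<in>topspace Z. p (k (t, z)) = h (t, z)) \<and>
           (\<forall>z\<in>topspace Z. k (0, z) = f z)))"

text \<open>The lifting property is demanded for all G-spaces, but a HOL formula cannot quantify over
  types. The test spaces below range over all G-spaces with points in the type
  \<^typ>\<open>'e \<times> (real \<Rightarrow> 'b)\<close>, which contains the mapping path space of \<open>p\<close>. Theorem
  \<open>G_fibration_lifting\<close> below shows that the lifting property then holds for G-spaces with
  points in any type whatsoever.\<close>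

definition G_fibration ::
  "('g, 'm) monoid_scheme \<Rightarrow> 'g topology \<Rightarrow> 'e topology \<Rightarrow> ('g \<Rightarrow> 'e \<Rightarrow> 'e) \<Rightarrow> 'b topology
     \<Rightarrow> ('g \<Rightarrow> 'b \<Rightarrow> 'b) \<Rightarrow> ('e \<Rightarrow> 'b) \<Rightarrow> bool" where
  "G_fibration G T E \<phi> B \<psi> p \<longleftrightarrow>
     G_space G T E \<phi> \<and> G_space G T B \<psi> \<and> G_map G E \<phi> B \<psi> p \<and>
     (\<forall>(Z :: ('e \<times> (real \<Rightarrow> 'b)) topology) \<zeta>.
        G_space G T Z \<zeta> \<longrightarrow> G_homotopy_lifting G E \<phi> B \<psi> p Z \<zeta>)"


section \<open>Equivariant sectional category and topological complexities\<close>

text \<open>An infimum over the empty set is \<open>\<infinity>\<close> in \<^typ>\<open>enat\<close>.\<close>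

definition secat ::
  "('g, 'm) monoid_scheme \<Rightarrow> 'a topology \<Rightarrow> ('g \<Rightarrow> 'a \<Rightarrow> 'a) \<Rightarrow> 'b topology \<Rightarrow> ('g \<Rightarrow> 'b \<Rightarrow> 'b)
     \<Rightarrow> ('a \<Rightarrow> 'b) \<Rightarrow> enat" where
  "secat G X \<phi> Y \<psi> q =
     Inf {enat k | k. 0 < k \<and>
       (\<exists>U :: nat \<Rightarrow> 'b set.
          (\<Union>i<k. U i) = topspace Y \<and>
          (\<forall>i<k. openin Y (U i) \<and> (\<forall>g\<in>carrier G. \<psi> g ` U i \<subseteq> U i) \<and>
             (\<exists>s. G_map G (subtopology Y (U i)) \<psi> X \<phi> s \<and>
                  G_homotopic G (subtopology Y (U i)) \<psi> Y \<psi> (q \<circ> s) (\<lambda>y. y))))}"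

definition prod_action ::
  "('x \<times> 'y) set \<Rightarrow> ('g \<Rightarrow> 'x \<Rightarrow> 'x) \<Rightarrow> ('h \<Rightarrow> 'y \<Rightarrow> 'y) \<Rightarrow> 'g \<times> 'h \<Rightarrow> 'x \<times> 'y \<Rightarrow> 'x \<times> 'y" where
  "prod_action S \<phi> \<psi> = (\<lambda>(g, h). restrict (map_prod (\<phi> g) (\<psi> h)) S)"

definition composable_mod ::
  "('g, 'm) monoid_scheme \<Rightarrow> ('g \<Rightarrow> 'e \<Rightarrow> 'e) \<Rightarrow> (real \<Rightarrow> 'e) topology
     \<Rightarrow> ((real \<Rightarrow> 'e) \<times> (real \<Rightarrow> 'e)) topology" where
  "composable_mod G \<phi> P =
     subtopology (prod_topology P P) {(\<gamma>, \<delta>). orbit G \<phi> (\<gamma> 1) = orbit G \<phi> (\<delta> 0)}"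

definition fibre_product_mod ::
  "('g, 'm) monoid_scheme \<Rightarrow> 'e topology \<Rightarrow> ('g \<Rightarrow> 'b \<Rightarrow> 'b) \<Rightarrow> ('e \<Rightarrow> 'b) \<Rightarrow> ('e \<times> 'e) topology" where
  "fibre_product_mod G E \<psi> p =
     subtopology (prod_topology E E) {(e1, e2). orbit G \<psi> (p e1) = orbit G \<psi> (p e2)}"

definition endpoints :: "(real \<Rightarrow> 'e) \<times> (real \<Rightarrow> 'e) \<Rightarrow> 'e \<times> 'e" where
  "endpoints = (\<lambda>(\<gamma>, \<delta>). (\<gamma> 0, \<delta> 1))"

definition invariant_param_TC ::
  "('g, 'm) monoid_scheme \<Rightarrow> 'e topology \<Rightarrow> ('g \<Rightarrow> 'e \<Rightarrow> 'e) \<Rightarrow> 'b topology \<Rightarrow> ('g \<Rightarrow> 'b \<Rightarrow> 'b)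
     \<Rightarrow> ('e \<Rightarrow> 'b) \<Rightarrow> enat" where
  "invariant_param_TC G E \<phi> B \<psi> p =
     (let X = composable_mod G \<phi> (fibre_path_space E B p);
          Y = fibre_product_mod G E \<psi> p
      in secat (G \<times>\<times> G) X (prod_action (topspace X) (path_action \<phi>) (path_action \<phi>))
           Y (prod_action (topspace Y) \<phi> \<phi>) endpoints)"

definition invariant_TC ::
  "('g, 'm) monoid_scheme \<Rightarrow> 'e topology \<Rightarrow> ('g \<Rightarrow> 'e \<Rightarrow> 'e) \<Rightarrow> enat" where
  "invariant_TC G E \<phi> =
     (let X = composable_mod G \<phi> (path_space E);
          Y = prod_topology E E
      in secat (G \<times>\<times> G) X (prod_action (topspace X) (path_action \<phi>) (path_action \<phi>))
           Y (prod_action (topspace Y) \<phi> \<phi>) endpoints)"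

definition param_TC :: "'e topology \<Rightarrow> 'b topology \<Rightarrow> ('e \<Rightarrow> 'b) \<Rightarrow> enat" where
  "param_TC E B p =
     (let Y = subtopology (prod_topology E E) {(e1, e2). p e1 = p e2}
      in Inf {enat k | k. 0 < k \<and>
           (\<exists>U :: nat \<Rightarrow> ('e \<times> 'e) set.
              (\<Union>i<k. U i) = topspace Y \<and>
              (\<forall>i<k. openin Y (U i) \<and>
                 (\<exists>s. continuous_map (subtopology Y (U i)) (fibre_path_space E B p) s \<and>
                      (\<forall>y\<in>U i. (s y 0, s y 1) = y))))})"


section \<open>The lifting property of a G-fibration for arbitrary test spaces\<close>

lemma topspace_compact_open:
  "topspace (compact_open X Y) = {f \<in> extensional (topspace X). continuous_map X Y f}"
proof -
  have "UNIV \<in> {{f. f ` K \<subseteq> U} | K U. compactin X K \<and> openin Y U}"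
    by (rule CollectI, rule exI[of _ "{}"], rule exI[of _ "{}"]) auto
  then show ?thesis
    unfolding compact_open_def topspace_subtopology topology_generated_by_topspace by blast
qed

lemma topspace_path_space:
  "topspace (path_space X) = {\<gamma> \<in> extensional {0..1}. pathin X \<gamma>}"
  by (simp add: path_space_def topspace_compact_open pathin_def)

lemma openin_compact_open_subbasis:
  assumes "compactin X K" "openin Y U"
  shows "openin (compact_open X Y) {f \<in> topspace (compact_open X Y). f ` K \<subseteq> U}"
proof -
  have "openin (topology_generated_by {{f. f ` K \<subseteq> U} | K U. compactin X K \<and> openin Y U})
          {f. f ` K \<subseteq> U}"
    using assms by (intro topology_generated_by_Basis) blast
  then have "openin (compact_open X Y)
      ({f. f ` K \<subseteq> U} \<inter> {f \<in> extensional (topspace X). continuous_map X Y f})"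
    unfolding compact_open_def by (rule openin_subtopology_Int)
  moreover have "{f. f ` K \<subseteq> U} \<inter> {f \<in> extensional (topspace X). continuous_map X Y f}
      = {f \<in> topspace (compact_open X Y). f ` K \<subseteq> U}"
    unfolding topspace_compact_open by blast
  ultimately show ?thesis by simp
qed

lemma continuous_map_curry:
  assumes f: "continuous_map (prod_topology W X) Y f"
  shows "continuous_map W (compact_open X Y) (\<lambda>w. \<lambda>x\<in>topspace X. f (w, x))"
proof -
  let ?c = "\<lambda>w. \<lambda>x\<in>topspace X. f (w, x)"
  have stage: "continuous_map X Y (?c w)" if "w \<in> topspace W" for w
  proof -
    have "continuous_map X Y (f \<circ> Pair w)"
      by (rule continuous_map_compose[OF _ f]) (use that in \<open>auto intro: continuous_map_pairedI\<close>)
    then show ?thesis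
      by (rule continuous_map_eq) simp
  qed
  have "continuous_map W
      (topology_generated_by {{f. f ` K \<subseteq> U} | K U. compactin X K \<and> openin Y U}) ?c"
  proof (rule continuous_on_generated_topo)
    fix V assume "V \<in> {{f. f ` K \<subseteq> U} | K U. compactin X K \<and> openin Y U}"
    then obtain K U where V: "V = {f. f ` K \<subseteq> U}" and K: "compactin X K" and U: "openin Y U"
      by blast
    have KX: "K \<subseteq> topspace X" using K by (rule compactin_subset_topspace)
    define N where "N = {z \<in> topspace (prod_topology W X). f z \<in> U}"
    have N: "openin (prod_topology W X) N"
      unfolding N_def by (rule openin_continuous_map_preimage[OF f U])
    show "openin W (?c -` V \<inter> topspace W)"
    proof (subst openin_subopen, intro ballI)
      fix w assume "w \<in> ?c -` V \<inter> topspace W"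
      then have w: "w \<in> topspace W" "{w} \<times> K \<subseteq> N"
        using KX by (auto simp: V N_def image_subset_iff subset_iff)
      then obtain A C where A: "openin W A" "w \<in> A" and C: "K \<subseteq> C" "A \<times> C \<subseteq> N"
        by (metis tube_lemma_right[OF N K w])
      have "A \<times> K \<subseteq> N" by (rule subset_trans[OF Sigma_mono[OF order_refl C(1)] C(2)])
      then have "A \<subseteq> ?c -` V \<inter> topspace W"
        using openin_subset[OF A(1)] KX by (force simp: V N_def)
      then show "\<exists>A. openin W A \<and> w \<in> A \<and> A \<subseteq> ?c -` V \<inter> topspace W"
        using A by blast
    qed
  next
    have "UNIV \<in> {{f. f ` K \<subseteq> U} | K U. compactin X K \<and> openin Y U}"
      by (rule CollectI, rule exI[of _ "{}"], rule exI[of _ "{}"]) auto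
    then show "?c ` topspace W \<subseteq> \<Union> {{f. f ` K \<subseteq> U} | K U. compactin X K \<and> openin Y U}"
      by blast
  qed
  then show ?thesis
    unfolding compact_open_def continuous_map_in_subtopology using stage by auto
qed

lemma continuous_map_eval:
  assumes X: "locally_compact_space X" "Hausdorff_space X"
  shows "continuous_map (prod_topology (compact_open X Y) X) Y (\<lambda>(f, x). f x)"
proof -
  let ?P = "prod_topology (compact_open X Y) X"
  have nb: "neighbourhood_base_of (compactin X) X"
    using X locally_compact_space_neighbourhood_base by blast
  have "openin ?P {z \<in> topspace ?P. (\<lambda>(f, x). f x) z \<in> U}" if U: "openin Y U" for U
  proof (subst openin_subopen, intro ballI)
    fix z assume "z \<in> {z \<in> topspace ?P. (\<lambda>(f, x). f x) z \<in> U}"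
    then obtain f x where z: "z = (f, x)" "f \<in> topspace (compact_open X Y)" "x \<in> topspace X"
        "f x \<in> U" by auto
    have f: "continuous_map X Y f" using z(2) by (simp add: topspace_compact_open)
    have "openin X {x \<in> topspace X. f x \<in> U}"
      by (rule openin_continuous_map_preimage[OF f U])
    then obtain A K where A: "openin X A" "compactin X K" "x \<in> A" "A \<subseteq> K"
        "K \<subseteq> {x \<in> topspace X. f x \<in> U}"
      using nb z(3,4) unfolding neighbourhood_base_of
      by (metis (no_types, lifting) mem_Collect_eq)
    let ?N = "{f \<in> topspace (compact_open X Y). f ` K \<subseteq> U}"
    have "openin ?P (?N \<times> A)"
      using openin_compact_open_subbasis[OF A(2) U] A(1) by (simp add: openin_prod_Times_iff)
    moreover have "z \<in> ?N \<times> A" using z A by auto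
    moreover have "?N \<times> A \<subseteq> {z \<in> topspace ?P. (\<lambda>(f, x). f x) z \<in> U}"
      using A(4,5) openin_subset[OF A(1)] by (auto simp: image_subset_iff)
    ultimately show "\<exists>V. openin ?P V \<and> z \<in> V \<and> V \<subseteq> {z \<in> topspace ?P. (\<lambda>(f, x). f x) z \<in> U}"
      by blast
  qed
  moreover have "(\<lambda>(f, x). f x) \<in> topspace ?P \<rightarrow> topspace Y"
    by (auto simp: topspace_compact_open continuous_map_def)
  ultimately show ?thesis
    unfolding continuous_map_def by blast
qed

lemma continuous_map_path_eval:
  "continuous_map (prod_topology (path_space X) (top_of_set {0..1})) X (\<lambda>(\<gamma>, t). \<gamma> t)"
  unfolding path_space_def
proof (rule continuous_map_eval)
  show "locally_compact_space (top_of_set {0..1::real})"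
    by (intro compact_imp_locally_compact_space) (simp add: compact_space_subtopology)
  show "Hausdorff_space (top_of_set {0..1::real})"
    by (simp add: Hausdorff_space_subtopology)
qed

lemma Hausdorff_space_path_space:
  assumes "Hausdorff_space X"
  shows "Hausdorff_space (path_space X)"
proof -
  have ev: "continuous_map (path_space X) X (\<lambda>\<gamma>. \<gamma> t)" if "t \<in> {0..1}" for t
  proof -
    have "continuous_map (path_space X) X ((\<lambda>(\<gamma>, t). \<gamma> t) \<circ> (\<lambda>\<gamma>. (\<gamma>, t)))"
      by (rule continuous_map_compose[OF _ continuous_map_path_eval])
         (use that in \<open>auto intro: continuous_map_pairedI\<close>)
    then show ?thesis by (simp add: o_def)
  qed
  show ?thesis
    unfolding Hausdorff_space_def
  proof (intro allI impI)
    fix \<gamma> \<delta> assume *: "\<gamma> \<in> topspace (path_space X) \<and> \<delta> \<in> topspace (path_space X) \<and> \<gamma> \<noteq> \<delta>"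
    then obtain t where t: "t \<in> {0..1}" "\<gamma> t \<noteq> \<delta> t"
      by (metis (mono_tags, lifting) extensionalityI mem_Collect_eq topspace_path_space)
    have "\<gamma> t \<in> topspace X" "\<delta> t \<in> topspace X"
      using * continuous_map_image_subset_topspace[OF ev[OF t(1)]] by auto
    then obtain U V where "openin X U" "openin X V" "\<gamma> t \<in> U" "\<delta> t \<in> V" "disjnt U V"
      using assms t(2) unfolding Hausdorff_space_def by metis
    then show "\<exists>U V. openin (path_space X) U \<and> openin (path_space X) V \<and> \<gamma> \<in> U \<and> \<delta> \<in> V \<and>
        disjnt U V"
      using * openin_continuous_map_preimage[OF ev[OF t(1)]]
      by (intro exI[of _ "{\<gamma> \<in> topspace (path_space X). \<gamma> t \<in> U}"]
                exI[of _ "{\<gamma> \<in> topspace (path_space X). \<gamma> t \<in> V}"]) (auto simp: disjnt_iff)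
  qed
qed

lemma group_actionI:
  assumes G: "group G"
    and ext: "\<And>g. g \<in> carrier G \<Longrightarrow> \<phi> g \<in> extensional S"
    and closed: "\<And>g x. g \<in> carrier G \<Longrightarrow> x \<in> S \<Longrightarrow> \<phi> g x \<in> S"
    and one: "\<And>x. x \<in> S \<Longrightarrow> \<phi> \<one>\<^bsub>G\<^esub> x = x"
    and mult: "\<And>g h x. g \<in> carrier G \<Longrightarrow> h \<in> carrier G \<Longrightarrow> x \<in> S \<Longrightarrow>
        \<phi> (g \<otimes>\<^bsub>G\<^esub> h) x = \<phi> g (\<phi> h x)"
  shows "group_action G S \<phi>"
proof -
  interpret group G by fact
  have Bij: "\<phi> g \<in> Bij S" if g: "g \<in> carrier G" for g
  proof -
    have "bij_betw (\<phi> g) S S"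
    proof (rule bij_betwI[where g = "\<phi> (inv\<^bsub>G\<^esub> g)"])
      show "\<phi> g \<in> S \<rightarrow> S" "\<phi> (inv\<^bsub>G\<^esub> g) \<in> S \<rightarrow> S" using g closed by auto
      show "\<phi> (inv\<^bsub>G\<^esub> g) (\<phi> g x) = x" if "x \<in> S" for x
        using mult[of "inv\<^bsub>G\<^esub> g" g x] g that one by simp
      show "\<phi> g (\<phi> (inv\<^bsub>G\<^esub> g) x) = x" if "x \<in> S" for x
        using mult[of g "inv\<^bsub>G\<^esub> g" x] g that one by simp
    qed
    then show ?thesis using ext g by (simp add: Bij_def)
  qed
  have "\<phi> (g \<otimes>\<^bsub>G\<^esub> h) = compose S (\<phi> g) (\<phi> h)" if "g \<in> carrier G" "h \<in> carrier G" for g h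
    by (rule extensionalityI[of _ S]) (use that ext mult in \<open>auto simp: compose_def\<close>)
  then have "\<phi> \<in> hom G (BijGroup S)"
    using Bij by (auto simp: hom_def BijGroup_def)
  then show ?thesis
    using G group_BijGroup
    by (simp add: group_action_def group_hom_def group_hom_axioms_def)
qed

theorem G_fibration_lifting:
  fixes Z :: "'z topology"
  assumes G: "topological_group G T"
    and p: "G_fibration G T E \<phi> B \<psi> p"
    and Z: "G_space G T Z \<zeta>"
  shows "G_homotopy_lifting G E \<phi> B \<psi> p Z \<zeta>"
  unfolding G_homotopy_lifting_def
proof (intro allI impI, elim conjE)
  fix f h
  assume f: "G_map G Z \<zeta> E \<phi> f"
    and h: "continuous_map (prod_topology (top_of_set {0..1::real}) Z) B h"
    and h_eq: "\<forall>t\<in>{0..1}. equivariant_on G (topspace Z) \<zeta> \<psi> (\<lambda>z. h (t, z))"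
    and h0: "\<forall>z\<in>topspace Z. h (0, z) = p (f z)"
  let ?I = "top_of_set {0..1::real}"
  have Ggrp: "group G" and TG: "topspace T = carrier G"
    using G by (auto simp: topological_group_def)
  interpret group G by fact
  have Esp: "G_space G T E \<phi>" and Bsp: "G_space G T B \<psi>" and pmap: "G_map G E \<phi> B \<psi> p"
    using p by (auto simp: G_fibration_def)
  interpret AE: group_action G "topspace E" \<phi> using Esp by (simp add: G_space_def)
  interpret AB: group_action G "topspace B" \<psi> using Bsp by (simp add: G_space_def)
  interpret AZ: group_action G "topspace Z" \<zeta> using Z by (simp add: G_space_def)
  have actE: "continuous_map (prod_topology T E) E (\<lambda>(g, x). \<phi> g x)"
    and actB: "continuous_map (prod_topology T B) B (\<lambda>(g, x). \<psi> g x)"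
    using Esp Bsp by (auto simp: G_space_def)
  have p_eq: "p (\<phi> g e) = \<psi> g (p e)" if "g \<in> carrier G" "e \<in> topspace E" for g e
    using pmap that by (auto simp: G_map_def equivariant_on_def)
  have E1: "\<phi> \<one>\<^bsub>G\<^esub> e = e" if "e \<in> topspace E" for e
    using that AE.id_eq_one by (metis restrict_apply')
  have B1: "\<psi> \<one>\<^bsub>G\<^esub> b = b" if "b \<in> topspace B" for b
    using that AB.id_eq_one by (metis restrict_apply')
  have in_B: "\<beta> t \<in> topspace B" if "\<beta> \<in> topspace (path_space B)" "t \<in> {0..1}" for \<beta> t
    using that unfolding topspace_path_space pathin_def continuous_map_def by auto

  define N where "N = subtopology (prod_topology E (path_space B)) {(e, \<beta>). p e = \<beta> 0}"
  define \<nu> where "\<nu> g = restrict (map_prod (\<phi> g) (path_action \<psi> g)) (topspace N)" for g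
  have topN: "topspace N = {(e, \<beta>). e \<in> topspace E \<and> \<beta> \<in> topspace (path_space B) \<and> p e = \<beta> 0}"
    unfolding N_def by auto

  have path_act: "path_action \<psi> g \<beta> \<in> topspace (path_space B)"
    if "g \<in> carrier G" "\<beta> \<in> topspace (path_space B)" for g \<beta>
  proof -
    have "continuous_map ?I B ((\<lambda>(g, x). \<psi> g x) \<circ> (\<lambda>t. (g, \<beta> t)))"
      by (rule continuous_map_compose[OF _ actB])
         (use that TG in \<open>auto intro!: continuous_map_pairedI simp: topspace_path_space pathin_def\<close>)
    then have "continuous_map ?I B (path_action \<psi> g \<beta>)"
      by (rule continuous_map_eq) (simp add: path_action_def)
    then show ?thesis by (simp add: topspace_path_space pathin_def path_action_def)
  qed
  have \<nu>_closed: "\<nu> g x \<in> topspace N" if g: "g \<in> carrier G" and xN: "x \<in> topspace N" for g x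
  proof -
    obtain e \<beta> where x: "x = (e, \<beta>)" "e \<in> topspace E" "\<beta> \<in> topspace (path_space B)"
        "p e = \<beta> 0"
      using xN by (auto simp: topN)
    have "\<phi> g e \<in> topspace E" using AE.element_image[OF g x(2)] by simp
    moreover have "p (\<phi> g e) = path_action \<psi> g \<beta> 0"
      using p_eq[OF g x(2)] x(4) by (simp add: path_action_def)
    ultimately show ?thesis
      using xN path_act[OF g x(3)] x(1) by (simp add: \<nu>_def topN)
  qed

  have Nsp: "G_space G T N \<nu>"
    unfolding G_space_def
  proof (intro conjI)
    show "Hausdorff_space N"
      using Esp Bsp unfolding N_def G_space_def
      by (intro Hausdorff_space_subtopology)
         (simp add: Hausdorff_space_prod_topology Hausdorff_space_path_space)
    show "group_action G (topspace N) \<nu>"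
    proof (rule group_actionI)
      fix x assume "x \<in> topspace N"
      then obtain e \<beta> where x: "x = (e, \<beta>)" "e \<in> topspace E" "\<beta> \<in> topspace (path_space B)"
        by (auto simp: topN)
      have "path_action \<psi> \<one>\<^bsub>G\<^esub> \<beta> = \<beta>"
        by (rule extensionalityI[of _ "{0..1}"])
           (use x(3) in_B B1 in \<open>auto simp: path_action_def topspace_path_space\<close>)
      then show "\<nu> \<one>\<^bsub>G\<^esub> x = x" using \<open>x \<in> topspace N\<close> x E1 by (simp add: \<nu>_def)
    next
      fix g h x assume gh: "g \<in> carrier G" "h \<in> carrier G" and xN: "x \<in> topspace N"
      then obtain e \<beta> where x: "x = (e, \<beta>)" "e \<in> topspace E" "\<beta> \<in> topspace (path_space B)"
        by (auto simp: topN)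
      have "path_action \<psi> (g \<otimes>\<^bsub>G\<^esub> h) \<beta> = path_action \<psi> g (path_action \<psi> h \<beta>)"
        using gh x(3) in_B by (auto simp: path_action_def fun_eq_iff AB.composition_rule)
      then have "map_prod (\<phi> (g \<otimes>\<^bsub>G\<^esub> h)) (path_action \<psi> (g \<otimes>\<^bsub>G\<^esub> h)) x
          = map_prod (\<phi> g) (path_action \<psi> g) (\<nu> h x)"
        using gh x xN by (simp add: \<nu>_def AE.composition_rule)
      then show "\<nu> (g \<otimes>\<^bsub>G\<^esub> h) x = \<nu> g (\<nu> h x)"
        using \<nu>_closed[OF gh(2) xN] xN unfolding \<nu>_def[of g] \<nu>_def[of "g \<otimes>\<^bsub>G\<^esub> h"] by simp
    qed (use Ggrp \<nu>_closed in \<open>auto simp: \<nu>_def\<close>)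
    have fstN: "continuous_map N E fst" and sndN: "continuous_map N (path_space B) snd"
      unfolding N_def
      by (auto intro: continuous_map_from_subtopology continuous_map_fst continuous_map_snd)
    have c1: "continuous_map (prod_topology T N) E (\<lambda>(g, x). \<phi> g (fst x))"
    proof -
      have "continuous_map (prod_topology T N) E ((\<lambda>(g, x). \<phi> g x) \<circ> (\<lambda>z. (fst z, fst (snd z))))"
        by (intro continuous_map_compose[OF _ actE] continuous_map_pairedI continuous_map_fst
              continuous_map_compose[OF continuous_map_snd fstN, unfolded o_def])
      then show ?thesis by (simp add: o_def case_prod_unfold)
    qed
    have c2: "continuous_map (prod_topology T N) (path_space B) (\<lambda>(g, x). path_action \<psi> g (snd x))"
    proof -
      let ?W = "prod_topology T N"
      have "continuous_map (prod_topology ?W ?I) (path_space B) (\<lambda>z. snd (snd (fst z)))"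
        using continuous_map_compose[OF continuous_map_compose[OF continuous_map_fst
              continuous_map_snd] sndN] by (simp add: o_def)
      then have "continuous_map (prod_topology ?W ?I) B
          ((\<lambda>(\<gamma>, t). \<gamma> t) \<circ> (\<lambda>z. (snd (snd (fst z)), snd z)))"
        by (intro continuous_map_compose[OF _ continuous_map_path_eval] continuous_map_pairedI
              continuous_map_snd)
      moreover have "continuous_map (prod_topology ?W ?I) T (\<lambda>z. fst (fst z))"
        using continuous_map_compose[OF continuous_map_fst continuous_map_fst] by (simp add: o_def)
      ultimately have "continuous_map (prod_topology ?W ?I) B
          ((\<lambda>(g, x). \<psi> g x) \<circ> (\<lambda>z. (fst (fst z), snd (snd (fst z)) (snd z))))"
        by (intro continuous_map_compose[OF _ actB] continuous_map_pairedI)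
           (auto simp: o_def)
      then have "continuous_map ?W (path_space B)
          (\<lambda>w. \<lambda>t\<in>topspace ?I. ((\<lambda>(g, x). \<psi> g x) \<circ> (\<lambda>z. (fst (fst z), snd (snd (fst z)) (snd z)))) (w, t))"
        unfolding path_space_def by (rule continuous_map_curry)
      then show ?thesis by (simp add: path_action_def case_prod_unfold)
    qed
    show "continuous_map (prod_topology T N) N (\<lambda>(g, x). \<nu> g x)"
    proof -
      have "continuous_map (prod_topology T N) (prod_topology E (path_space B))
          (\<lambda>z. (\<phi> (fst z) (fst (snd z)), path_action \<psi> (fst z) (snd (snd z))))"
        using c1 c2 by (intro continuous_map_pairedI) (auto simp: case_prod_unfold)
      then have "continuous_map (prod_topology T N) (prod_topology E (path_space B))
          (\<lambda>(g, x). \<nu> g x)"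
        by (rule continuous_map_eq) (auto simp: \<nu>_def)
      moreover have "(\<lambda>(g, x). \<nu> g x) \<in> topspace (prod_topology T N) \<rightarrow> topspace N"
        using \<nu>_closed TG by auto
      ultimately show ?thesis
        unfolding N_def continuous_map_in_subtopology by (auto simp: Pi_iff)
    qed
  qed

  have lift: "G_homotopy_lifting G E \<phi> B \<psi> p N \<nu>"
    using p Nsp by (simp add: G_fibration_def)
  have fstN: "continuous_map N E fst" and sndN: "continuous_map N (path_space B) snd"
    unfolding N_def
    by (auto intro: continuous_map_from_subtopology continuous_map_fst continuous_map_snd)
  have "G_map G N \<nu> E \<phi> fst"
    using fstN by (auto simp: G_map_def equivariant_on_def \<nu>_def)
  moreover have "continuous_map (prod_topology ?I N) B (\<lambda>(t, x). snd x t)"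
  proof -
    have "continuous_map (prod_topology ?I N) (path_space B) (\<lambda>z. snd (snd z))"
      using continuous_map_compose[OF continuous_map_snd sndN] by (simp add: o_def)
    then have "continuous_map (prod_topology ?I N) B
        ((\<lambda>(\<gamma>, t). \<gamma> t) \<circ> (\<lambda>z. (snd (snd z), fst z)))"
      by (intro continuous_map_compose[OF _ continuous_map_path_eval] continuous_map_pairedI
              continuous_map_fst)
    then show ?thesis by (simp add: o_def case_prod_unfold)
  qed
  moreover have "\<forall>t\<in>{0..1}. equivariant_on G (topspace N) \<nu> \<psi> (\<lambda>x. (\<lambda>(t, x). snd x t) (t, x))"
    by (auto simp: equivariant_on_def \<nu>_def path_action_def)
  moreover have "\<forall>x\<in>topspace N. (\<lambda>(t, x). snd x t) (0, x) = p (fst x)"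
    by (auto simp: topN)
  ultimately obtain k where k: "continuous_map (prod_topology ?I N) E k"
    and k_eq: "\<forall>t\<in>{0..1}. equivariant_on G (topspace N) \<nu> \<phi> (\<lambda>x. k (t, x))"
    and pk: "\<forall>t\<in>{0..1}. \<forall>x\<in>topspace N. p (k (t, x)) = (\<lambda>(t, x). snd x t) (t, x)"
    and k0: "\<forall>x\<in>topspace N. k (0, x) = fst x"
    using lift unfolding G_homotopy_lifting_def by blast

  define \<theta> where "\<theta> z = (f z, \<lambda>t\<in>{0..1}. h (t, z))" for z
  have "continuous_map (prod_topology Z ?I) B (h \<circ> (\<lambda>x. (snd x, fst x)))"
    by (intro continuous_map_compose[OF _ h] continuous_map_pairedI continuous_map_fst
          continuous_map_snd)
  from continuous_map_curry[OF this]
  have "continuous_map Z (path_space B) (\<lambda>z. \<lambda>t\<in>{0..1}. h (t, z))"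
    by (simp add: path_space_def)
  then have "continuous_map Z (prod_topology E (path_space B)) \<theta>"
    unfolding \<theta>_def using f by (intro continuous_map_pairedI) (auto simp: G_map_def)
  then have \<theta>: "continuous_map Z N \<theta>"
    unfolding N_def continuous_map_in_subtopology using h0 by (auto simp: \<theta>_def)
  then have \<theta>N: "\<theta> z \<in> topspace N" if "z \<in> topspace Z" for z
    using that by (auto simp: continuous_map_def)
  have \<theta>_eq: "\<theta> (\<zeta> g z) = \<nu> g (\<theta> z)" if "g \<in> carrier G" "z \<in> topspace Z" for g z
    using \<theta>N[OF that(2)] that f h_eq
    by (auto simp: \<nu>_def \<theta>_def path_action_def G_map_def equivariant_on_def fun_eq_iff)

  show "\<exists>k. continuous_map (prod_topology ?I Z) E k \<and>
      (\<forall>t\<in>{0..1}. equivariant_on G (topspace Z) \<zeta> \<phi> (\<lambda>z. k (t, z))) \<and>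
      (\<forall>t\<in>{0..1}. \<forall>z\<in>topspace Z. p (k (t, z)) = h (t, z)) \<and>
      (\<forall>z\<in>topspace Z. k (0, z) = f z)"
  proof (intro exI[of _ "\<lambda>x. k (fst x, \<theta> (snd x))"] conjI)
    have "continuous_map (prod_topology ?I Z) E (k \<circ> (\<lambda>x. (fst x, \<theta> (snd x))))"
      by (intro continuous_map_compose[OF _ k] continuous_map_pairedI continuous_map_fst
            continuous_map_compose[OF continuous_map_snd \<theta>, unfolded o_def])
    then show "continuous_map (prod_topology ?I Z) E (\<lambda>x. k (fst x, \<theta> (snd x)))"
      by (simp add: o_def)
    show "\<forall>t\<in>{0..1}. equivariant_on G (topspace Z) \<zeta> \<phi> (\<lambda>z. k (fst (t, z), \<theta> (snd (t, z))))"
      using k_eq \<theta>N \<theta>_eq by (simp add: equivariant_on_def)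
    show "\<forall>t\<in>{0..1}. \<forall>z\<in>topspace Z. p (k (fst (t, z), \<theta> (snd (t, z)))) = h (t, z)"
      using pk \<theta>N by (simp add: \<theta>_def)
    show "\<forall>z\<in>topspace Z. k (fst (0, z), \<theta> (snd (0, z))) = f z"
      using k0 \<theta>N by (simp add: \<theta>_def)
  qed
qed

end

theory Submission
  imports Defs
begin

text \<open>Over a point every path is vertical and any two points lie over the same orbit, so the
  invariant parametrized and the invariant complexity are the sectional category of literally the
  same map.

  If all actions are trivial, then the orbit conditions become equations and equivariance carries
  no information. What remains is to compare two notions on an open set
  \<open>U \<subseteq> E \<times>\<^sub>B E\<close>. For \<open>TC\<close> there is a strict choice of a vertical path from \<open>e1\<close> to \<open>e2\<close>;
  for \<open>TC\<^sup>G\<close> there is a choice of a pair of vertical paths \<open>\<gamma>, \<delta>\<close> with \<open>\<gamma> 1 = \<delta> 0\<close>, whose outer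
  ends agree with \<open>(e1, e2)\<close> only up to a homotopy in \<open>E \<times>\<^sub>B E\<close>. A strict choice is turned into a
  pair by appending the constant path at \<open>e2\<close>.

  For the converse (\<open>vertical_paths_transport\<close>), let \<open>(H1, H2)\<close> be the homotopy. Travelling along
  \<open>H1\<close> backwards, then along \<open>\<gamma>\<close> and \<open>\<delta>\<close>, then along \<open>H2\<close> connects \<open>e1\<close> to \<open>e2\<close>, but leaves the
  fibre. As \<open>p \<circ> H1 = p \<circ> H2\<close>, the image of this journey in \<open>B\<close> runs along a path to its start,
  waits there, and returns the same way; it is therefore contractible relative to its ends. The
  homotopy lifting property, applied to this contraction with \<open>I \<times> U\<close> as test space, pushes the
  journey into the fibre (\<open>vertical_paths_by_contraction\<close>), and does so continuously in the point
  of \<open>U\<close>.\<close>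


section \<open>Families of paths\<close>

abbreviation unit_interval :: "real topology" where
  "unit_interval \<equiv> top_of_set {0..1}"

lemma continuous_map_unit_interval:
  "continuous_map V unit_interval a \<longleftrightarrow>
     continuous_map V euclideanreal a \<and> (\<forall>v\<in>topspace V. a v \<in> {0..1})"
  by (auto simp: continuous_map_in_subtopology Pi_iff)

lemma continuous_map_reparametrize:
  assumes "continuous_map (prod_topology unit_interval W) Y F"
    and "continuous_map V euclideanreal a" "\<And>v. v \<in> topspace V \<Longrightarrow> a v \<in> {0..1}"
    and "continuous_map V W b"
  shows "continuous_map V Y (\<lambda>v. F (a v, b v))"
proof -
  have "continuous_map V (prod_topology unit_interval W) (\<lambda>v. (a v, b v))"
    using assms by (intro continuous_map_pairedI) (auto simp: continuous_map_unit_interval)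
  then show ?thesis
    using continuous_map_compose[OF _ assms(1)] by (simp add: o_def)
qed

lemma continuous_map_real_fst:
  "continuous_map (prod_topology unit_interval W) euclideanreal fst"
  using continuous_map_fst continuous_map_in_subtopology by blast

lemma path_in_topspace:
  assumes "\<gamma> \<in> topspace (path_space X)" "t \<in> {0..1}"
  shows "\<gamma> t \<in> topspace X"
  using assms by (auto simp: topspace_path_space pathin_def continuous_map_def Pi_iff)

lemma continuous_map_path_family_eval:
  assumes "continuous_map W (path_space X) \<sigma>"
  shows "continuous_map (prod_topology unit_interval W) X (\<lambda>(t, y). \<sigma> y t)"
proof -
  have "continuous_map (prod_topology unit_interval W)
      (prod_topology (path_space X) unit_interval) (\<lambda>z. (\<sigma> (snd z), fst z))"
    by (intro continuous_map_pairedI continuous_map_fst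
        continuous_map_compose[OF continuous_map_snd assms, unfolded o_def])
  from continuous_map_compose[OF this continuous_map_path_eval] show ?thesis
    by (simp add: o_def case_prod_unfold)
qed

text \<open>Maps into the space of vertical paths are built by currying, so from here on a family of
  paths is handled as a map on \<open>I \<times> W\<close>, where continuity can be checked by composition and
  pasting.\<close>

lemma continuous_map_into_fibre_path_space:
  assumes p: "continuous_map X B p"
    and F: "continuous_map (prod_topology unit_interval W) X F"
    and vertical: "\<And>t y. t \<in> {0..1} \<Longrightarrow> y \<in> topspace W \<Longrightarrow> p (F (t, y)) = c y"
  shows "continuous_map W (fibre_path_space X B p) (\<lambda>y. \<lambda>t\<in>{0..1}. F (t, y))"
  unfolding fibre_path_space_def
proof (rule continuous_map_into_subtopology)
  have "continuous_map (prod_topology W unit_interval) X (F \<circ> (\<lambda>z. (snd z, fst z)))"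
    by (intro continuous_map_compose[OF _ F] continuous_map_pairedI continuous_map_fst
        continuous_map_snd)
  from continuous_map_curry[OF this]
  show "continuous_map W (path_space X) (\<lambda>y. \<lambda>t\<in>{0..1}. F (t, y))"
    by (simp add: path_space_def)
  have "c y \<in> topspace B" if y: "y \<in> topspace W" for y
  proof -
    have "F (0, y) \<in> topspace X" using y continuous_map_image_subset_topspace[OF F] by auto
    then show ?thesis
      using vertical[OF _ y, of 0] continuous_map_image_subset_topspace[OF p] by force
  qed
  then show "(\<lambda>y. \<lambda>t\<in>{0..1}. F (t, y)) \<in>
      topspace W \<rightarrow> {\<gamma>. \<exists>b\<in>topspace B. \<forall>t\<in>{0..1}. p (\<gamma> t) = b}"
    using vertical by fastforce
qed

definition join_families :: "(real \<times> 'w \<Rightarrow> 'x) \<Rightarrow> (real \<times> 'w \<Rightarrow> 'x) \<Rightarrow> real \<times> 'w \<Rightarrow> 'x" where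
  "join_families F H = (\<lambda>(t, y). if t \<le> 1/2 then F (2 * t, y) else H (2 * t - 1, y))"

lemma continuous_map_join_families:
  assumes F: "continuous_map (prod_topology unit_interval W) X F"
    and H: "continuous_map (prod_topology unit_interval W) X H"
    and meet: "\<And>y. y \<in> topspace W \<Longrightarrow> F (1, y) = H (0, y)"
  shows "continuous_map (prod_topology unit_interval W) X (join_families F H)"
proof -
  let ?P = "prod_topology unit_interval W"
  have fst: "continuous_map (subtopology ?P S) euclideanreal fst" for S
    by (intro continuous_map_from_subtopology continuous_map_real_fst)
  have snd: "continuous_map (subtopology ?P S) W snd" for S
    by (intro continuous_map_from_subtopology continuous_map_snd)
  have "continuous_map ?P X
      (\<lambda>z. if fst z \<le> 1/2 then F (2 * fst z, snd z) else H (2 * fst z - 1, snd z))"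
  proof (rule continuous_map_cases_le)
    show "continuous_map (subtopology ?P {z \<in> topspace ?P. fst z \<le> 1/2}) X
        (\<lambda>z. F (2 * fst z, snd z))"
      by (intro continuous_map_reparametrize[OF F] continuous_intros fst snd) auto
    show "continuous_map (subtopology ?P {z \<in> topspace ?P. 1/2 \<le> fst z}) X
        (\<lambda>z. H (2 * fst z - 1, snd z))"
      by (intro continuous_map_reparametrize[OF H] continuous_intros fst snd) auto
  next
    fix z assume z: "z \<in> topspace ?P" "fst z = 1/2"
    then have "snd z \<in> topspace W" "2 * fst z = 1" by auto
    then show "F (2 * fst z, snd z) = H (2 * fst z - 1, snd z)" using meet by simp
  qed (use continuous_map_real_fst in auto)
  then show ?thesis
    by (simp add: join_families_def case_prod_unfold)
qed


section \<open>Lifting paths into a single fibre\<close>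

definition has_homotopy_lifting ::
  "'e topology \<Rightarrow> 'b topology \<Rightarrow> ('e \<Rightarrow> 'b) \<Rightarrow> 'z topology \<Rightarrow> bool" where
  "has_homotopy_lifting E B p Z \<longleftrightarrow>
     (\<forall>f h. continuous_map Z E f \<and> continuous_map (prod_topology unit_interval Z) B h \<and>
        (\<forall>z\<in>topspace Z. h (0, z) = p (f z)) \<longrightarrow>
        (\<exists>k. continuous_map (prod_topology unit_interval Z) E k \<and>
           (\<forall>t\<in>{0..1}. \<forall>z\<in>topspace Z. p (k (t, z)) = h (t, z)) \<and>
           (\<forall>z\<in>topspace Z. k (0, z) = f z)))"

lemma G_space_trivial:
  assumes "topological_group G T" "Hausdorff_space Z"
  shows "G_space G T Z (\<lambda>g. \<lambda>z\<in>topspace Z. z)"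
proof -
  have "continuous_map (prod_topology T Z) Z (\<lambda>(g, z). (\<lambda>z\<in>topspace Z. z) z)"
    using continuous_map_snd[of T Z] by (rule continuous_map_eq) auto
  moreover have "group_action G (topspace Z) (\<lambda>g. \<lambda>z\<in>topspace Z. z)"
    by (rule group_actionI) (use assms in \<open>auto simp: topological_group_def\<close>)
  ultimately show ?thesis
    using assms by (simp add: G_space_def)
qed

text \<open>Any Hausdorff space is a G-space under the trivial action, and between trivial G-spaces
  every map is equivariant; hence the G-homotopy lifting property contains the ordinary one.\<close>

lemma G_fibration_trivial_action_lifting:
  fixes Z :: "'z topology"
  assumes G: "topological_group G T" and p: "G_fibration G T E \<phi> B \<psi> p"
    and triv: "trivial_action G E \<phi>" "trivial_action G B \<psi>" and Z: "Hausdorff_space Z"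
  shows "has_homotopy_lifting E B p Z"
  unfolding has_homotopy_lifting_def
proof (intro allI impI, elim conjE)
  fix f h
  assume f: "continuous_map Z E f" and h: "continuous_map (prod_topology unit_interval Z) B h"
    and h0: "\<forall>z\<in>topspace Z. h (0, z) = p (f z)"
  let ?\<zeta> = "\<lambda>g. \<lambda>z\<in>topspace Z. z"
  have "f z \<in> topspace E" if "z \<in> topspace Z" for z
    using f that by (auto simp: continuous_map_def)
  then have "G_map G Z ?\<zeta> E \<phi> f"
    using f triv(1) by (simp add: G_map_def equivariant_on_def trivial_action_def)
  moreover have "h (t, z) \<in> topspace B" if "t \<in> {0..1}" "z \<in> topspace Z" for t z
    using continuous_map_image_subset_topspace[OF h] that by auto
  then have "\<forall>t\<in>{0..1}. equivariant_on G (topspace Z) ?\<zeta> \<psi> (\<lambda>z. h (t, z))"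
    using triv(2) by (simp add: equivariant_on_def trivial_action_def)
  ultimately show "\<exists>k. continuous_map (prod_topology unit_interval Z) E k \<and>
      (\<forall>t\<in>{0..1}. \<forall>z\<in>topspace Z. p (k (t, z)) = h (t, z)) \<and>
      (\<forall>z\<in>topspace Z. k (0, z) = f z)"
    using G_fibration_lifting[OF G p G_space_trivial[OF G Z]] h h0
    unfolding G_homotopy_lifting_def by blast
qed

text \<open>The homotopy \<open>Q\<close> contracts the loops \<open>p \<circ> w\<close> relative to their ends. Lift it, starting at
  \<open>w\<close>: on the square \<open>(s, r) \<in> I \<times> I\<close> the lift starts with \<open>w\<close> on the side \<open>s = 0\<close>, while its other
  three sides lie in the fibre over \<open>c y\<close>, because \<open>Q\<close> equals \<open>c y\<close> there. Those three sides form
  a vertical path with the same ends as \<open>w\<close>. The lift is prescribed on the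
  side \<open>s = 0\<close> alone, and this is what the absolute lifting property provides.\<close>

lemma vertical_paths_by_contraction:
  assumes p: "continuous_map E B p"
    and lift: "has_homotopy_lifting E B p (prod_topology unit_interval W)"
    and w: "continuous_map (prod_topology unit_interval W) E w"
    and Q: "continuous_map (prod_topology unit_interval (prod_topology unit_interval W)) B Q"
    and Q0: "\<And>r y. r \<in> {0..1} \<Longrightarrow> y \<in> topspace W \<Longrightarrow> Q (0, r, y) = p (w (r, y))"
    and sides: "\<And>s y. s \<in> {0..1} \<Longrightarrow> y \<in> topspace W \<Longrightarrow>
        Q (s, 0, y) = c y \<and> Q (s, 1, y) = c y \<and> Q (1, s, y) = c y"
  obtains \<sigma> where "continuous_map W (fibre_path_space E B p) \<sigma>"
    and "\<And>y. y \<in> topspace W \<Longrightarrow> \<sigma> y 0 = w (0, y) \<and> \<sigma> y 1 = w (1, y)"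
proof -
  let ?I = unit_interval
  obtain K where K: "continuous_map (prod_topology ?I (prod_topology ?I W)) E K"
    and pK: "\<And>s r y. s \<in> {0..1} \<Longrightarrow> r \<in> {0..1} \<Longrightarrow> y \<in> topspace W \<Longrightarrow>
        p (K (s, r, y)) = Q (s, r, y)"
    and K0: "\<And>r y. r \<in> {0..1} \<Longrightarrow> y \<in> topspace W \<Longrightarrow> K (0, r, y) = w (r, y)"
    using lift[unfolded has_homotopy_lifting_def, rule_format, of w Q] w Q Q0 by auto
  \<comment> \<open>As \<open>t\<close> runs through the thirds of \<open>I\<close>, the point \<open>(a t, b t)\<close> goes from \<open>(0, 0)\<close> to \<open>(1, 0)\<close>
    to \<open>(1, 1)\<close> to \<open>(0, 1)\<close>.\<close>
  define a b :: "real \<Rightarrow> real"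
    where "a t = min 1 (min (3 * t) (3 - 3 * t))" and "b t = max 0 (min 1 (3 * t - 1))" for t
  define F where "F = (\<lambda>z. K (a (fst z), b (fst z), snd z))"
  have "continuous_map (prod_topology ?I W) E F"
    unfolding F_def a_def b_def
    by (intro continuous_map_reparametrize[OF K] continuous_map_pairedI continuous_intros
        continuous_map_real_fst) (auto simp: continuous_map_unit_interval
        intro!: continuous_intros continuous_map_real_fst)
  moreover have "p (F (t, y)) = c y" if t: "t \<in> {0..1}" and y: "y \<in> topspace W" for t y
  proof -
    have "a t \<in> {0..1}" "b t \<in> {0..1}" using t by (auto simp: a_def b_def)
    moreover have "b t = 0 \<or> b t = 1 \<or> a t = 1" by (auto simp: a_def b_def min_def max_def)
    ultimately show ?thesis
      using pK[of "a t" "b t" y] sides[of "a t" y] sides[of "b t" y] y by (auto simp: F_def)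
  qed
  ultimately have "continuous_map W (fibre_path_space E B p) (\<lambda>y. \<lambda>t\<in>{0..1}. F (t, y))"
    by (rule continuous_map_into_fibre_path_space[OF p])
  moreover have "F (0, y) = w (0, y)" "F (1, y) = w (1, y)" if "y \<in> topspace W" for y
    using K0 that by (auto simp: F_def a_def b_def)
  ultimately show thesis
    by (intro that[of "\<lambda>y. \<lambda>t\<in>{0..1}. F (t, y)"]) auto
qed

text \<open>This is the part of the homotopy lifting property of \<open>\<gamma> \<mapsto> (\<gamma> 0, \<gamma> 1)\<close> that the comparison
  uses: a family of vertical paths is carried along a homotopy of its ends within the fibre
  product. Write \<open>\<beta> = p \<circ> H1 = p \<circ> H2\<close>. The journey \<open>w\<close> spends a quarter of the time on each of the
  reverse of \<open>H1\<close>, \<open>\<gamma>\<close>, \<open>\<delta>\<close> and \<open>H2\<close>, so at time \<open>r\<close> its image in \<open>B\<close> is \<open>\<beta> (\<theta> r)\<close>, where \<open>\<theta>\<close>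
  falls from 1 to 0, rests, and rises to 1 again. Replacing \<open>\<theta> r\<close> by \<open>max s (\<theta> r)\<close> cuts off more
  and more of the excursion and contracts it to its end point \<open>\<beta> 1\<close>.\<close>

lemma vertical_paths_transport:
  assumes p: "continuous_map E B p"
    and lift: "has_homotopy_lifting E B p (prod_topology unit_interval W)"
    and \<gamma>: "continuous_map W (fibre_path_space E B p) \<gamma>"
    and \<delta>: "continuous_map W (fibre_path_space E B p) \<delta>"
    and meet: "\<And>y. y \<in> topspace W \<Longrightarrow> \<gamma> y 1 = \<delta> y 0"
    and H: "continuous_map (prod_topology unit_interval W) E H1"
      "continuous_map (prod_topology unit_interval W) E H2"
    and fibre: "\<And>t y. t \<in> {0..1} \<Longrightarrow> y \<in> topspace W \<Longrightarrow> p (H1 (t, y)) = p (H2 (t, y))"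
    and start: "\<And>y. y \<in> topspace W \<Longrightarrow> H1 (0, y) = \<gamma> y 0 \<and> H2 (0, y) = \<delta> y 1"
  obtains \<sigma> where "continuous_map W (fibre_path_space E B p) \<sigma>"
    and "\<And>y. y \<in> topspace W \<Longrightarrow> \<sigma> y 0 = H1 (1, y) \<and> \<sigma> y 1 = H2 (1, y)"
proof -
  let ?I = unit_interval
  let ?\<gamma> = "\<lambda>(t, y). \<gamma> y t" and ?\<delta> = "\<lambda>(t, y). \<delta> y t" and ?R = "\<lambda>z. H1 (1 - fst z, snd z)"
  have vertical: "p (\<alpha> y t) = p (\<alpha> y t')"
    if "continuous_map W (fibre_path_space E B p) \<alpha>" "y \<in> topspace W" "t \<in> {0..1}" "t' \<in> {0..1}"
    for \<alpha> y t t'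
  proof -
    have "\<exists>b\<in>topspace B. \<forall>t\<in>{0..1}. p (\<alpha> y t) = b"
      using that(1,2) unfolding fibre_path_space_def continuous_map_in_subtopology by blast
    then show ?thesis using that(3,4) by force
  qed
  define w where "w = join_families (join_families ?R ?\<gamma>) (join_families ?\<delta> H2)"
  define \<theta> :: "real \<Rightarrow> real" where "\<theta> r = max 0 (\<bar>4 * r - 2\<bar> - 1)" for r
  define Q where "Q = (\<lambda>z. p (H1 (max (fst z) (\<theta> (fst (snd z))), snd (snd z))))"
  have "continuous_map (prod_topology ?I W) E ?R"
    by (intro continuous_map_reparametrize[OF H(1)] continuous_intros continuous_map_real_fst) auto
  moreover have "continuous_map (prod_topology ?I W) E ?\<gamma>" "continuous_map (prod_topology ?I W) E ?\<delta>"
    using \<gamma> \<delta> unfolding fibre_path_space_def continuous_map_in_subtopology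
    by (auto intro: continuous_map_path_family_eval)
  ultimately have w: "continuous_map (prod_topology ?I W) E w"
    unfolding w_def using H meet start
    by (intro continuous_map_join_families) (auto simp: join_families_def)
  have \<theta>: "\<theta> r \<in> {0..1}" if "r \<in> {0..1}" for r
    using that by (auto simp: \<theta>_def)
  have "continuous_map (prod_topology ?I (prod_topology ?I W)) E
      (\<lambda>z. H1 (max (fst z) (\<theta> (fst (snd z))), snd (snd z)))"
    unfolding \<theta>_def
    by (intro continuous_map_reparametrize[OF H(1)] continuous_intros continuous_map_real_fst
        continuous_map_compose[OF continuous_map_snd continuous_map_real_fst, unfolded o_def]
        continuous_map_compose[OF continuous_map_snd continuous_map_snd, unfolded o_def]) auto
  then have Q: "continuous_map (prod_topology ?I (prod_topology ?I W)) B Q"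
    unfolding Q_def using continuous_map_compose[OF _ p] by (simp add: o_def)
  show thesis
  proof (rule vertical_paths_by_contraction[OF p lift w Q])
    fix r y assume r: "r \<in> {0..1::real}" and y: "y \<in> topspace W"
    consider "r \<le> 1/4" | "1/4 < r" "r \<le> 1/2" | "1/2 < r" "r \<le> 3/4" | "3/4 < r" by linarith
    then show "Q (0, r, y) = p (w (r, y))"
    proof cases
      case 1
      then have "\<theta> r = 1 - 4 * r" "w (r, y) = H1 (1 - 4 * r, y)"
        by (auto simp: \<theta>_def w_def join_families_def)
      then show ?thesis using 1 by (simp add: Q_def)
    next
      case 2
      then have "\<theta> r = 0" "w (r, y) = \<gamma> y (4 * r - 1)"
        by (auto simp: \<theta>_def w_def join_families_def)
      then show ?thesis
        using 2 start[OF y] vertical[OF \<gamma> y, of 0 "4 * r - 1"] by (simp add: Q_def)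
    next
      case 3
      then have "\<theta> r = 0" "w (r, y) = \<delta> y (4 * r - 2)"
        by (auto simp: \<theta>_def w_def join_families_def)
      then show ?thesis
        using 3 start[OF y] fibre[OF _ y, of 0] vertical[OF \<delta> y, of 1 "4 * r - 2"]
        by (simp add: Q_def)
    next
      case 4
      then have "\<theta> r = 4 * r - 3" "w (r, y) = H2 (4 * r - 3, y)"
        by (auto simp: \<theta>_def w_def join_families_def)
      then show ?thesis using 4 r fibre[OF _ y, of "4 * r - 3"] by (simp add: Q_def)
    qed
  next
    fix s y assume "s \<in> {0..1::real}" "y \<in> topspace W"
    then show "Q (s, 0, y) = p (H1 (1, y)) \<and> Q (s, 1, y) = p (H1 (1, y)) \<and>
        Q (1, s, y) = p (H1 (1, y))"
      using \<theta>[of s] by (auto simp: Q_def \<theta>_def max_def)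
  next
    fix \<sigma> assume \<sigma>: "continuous_map W (fibre_path_space E B p) \<sigma>"
      "\<And>y. y \<in> topspace W \<Longrightarrow> \<sigma> y 0 = w (0, y) \<and> \<sigma> y 1 = w (1, y)"
    show thesis
      by (rule that[OF \<sigma>(1)]) (use \<sigma>(2) in \<open>simp add: w_def join_families_def\<close>)
  qed
qed


section \<open>Trivial actions\<close>

lemma subtopology_eqI:
  assumes "topspace X \<inter> S = topspace X \<inter> S'"
  shows "subtopology X S = subtopology X S'"
  using assms by (metis subtopology_restrict)

lemma orbit_trivial_action:
  assumes G: "group G" and triv: "trivial_action G X \<phi>" and x: "x \<in> topspace X"
  shows "orbit G \<phi> x = {x}"
proof -
  have "\<phi> g x = x" if "g \<in> carrier G" for g
    using triv x that by (simp add: trivial_action_def)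
  moreover have "carrier G \<noteq> {}"
    using G group.is_monoid monoid.one_closed by blast
  ultimately show ?thesis
    unfolding orbit_def by force
qed

lemma trivial_action_path_action:
  assumes "trivial_action G X \<phi>"
  shows "trivial_action G (path_space X) (path_action \<phi>)"
  unfolding trivial_action_def
proof (intro ballI)
  fix g \<gamma> assume g: "g \<in> carrier G" and \<gamma>: "\<gamma> \<in> topspace (path_space X)"
  then have "\<gamma> t \<in> topspace X" if "t \<in> {0..1}" for t
    using that path_in_topspace by blast
  then show "path_action \<phi> g \<gamma> = \<gamma>"
    using assms g \<gamma>
    by (intro extensionalityI[of _ "{0..1}"])
       (auto simp: path_action_def trivial_action_def topspace_path_space)
qed

lemma trivial_action_prod_action:
  assumes "trivial_action G X \<phi>" "trivial_action H Y \<psi>"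
    and "topspace Z \<subseteq> topspace X \<times> topspace Y"
  shows "trivial_action (G \<times>\<times> H) Z (prod_action (topspace Z) \<phi> \<psi>)"
  unfolding trivial_action_def
proof (intro ballI)
  fix gh z assume "gh \<in> carrier (G \<times>\<times> H)" and z: "z \<in> topspace Z"
  then obtain g h where gh: "gh = (g, h)" "g \<in> carrier G" "h \<in> carrier H"
    by (auto simp: DirProd_def)
  moreover have "fst z \<in> topspace X" "snd z \<in> topspace Y" using assms(3) z by auto
  ultimately show "prod_action (topspace Z) \<phi> \<psi> gh z = z"
    using assms(1,2) z unfolding gh(1) by (cases z) (simp add: prod_action_def trivial_action_def)
qed

lemma equivariant_on_trivial_action:
  assumes "trivial_action G X \<phi>" "trivial_action G Y \<psi>" "S \<subseteq> topspace X" "f ` S \<subseteq> topspace Y"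
  shows "equivariant_on G S \<phi> \<psi> f"
  unfolding equivariant_on_def
proof (intro ballI)
  fix g x assume "g \<in> carrier G" "x \<in> S"
  moreover from this have "x \<in> topspace X" "f x \<in> topspace Y" using assms by auto
  ultimately show "f (\<phi> g x) = \<psi> g (f x)"
    using assms(1,2) by (simp add: trivial_action_def)
qed

text \<open>Every subset is invariant and every map is equivariant, including all stages of a
  homotopy, so the equivariant conditions in the sectional category are automatic.\<close>

lemma secat_trivial_action:
  assumes X: "trivial_action G X \<phi>" and Y: "trivial_action G Y \<psi>"
  shows "secat G X \<phi> Y \<psi> q =
     Inf {enat k | k. 0 < k \<and>
       (\<exists>U :: nat \<Rightarrow> 'b set.
          (\<Union>i<k. U i) = topspace Y \<and>
          (\<forall>i<k. openin Y (U i) \<and>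
             (\<exists>s. continuous_map (subtopology Y (U i)) X s \<and>
                  homotopic_with (\<lambda>_. True) (subtopology Y (U i)) Y (q \<circ> s) (\<lambda>y. y))))}"
proof -
  have eq: "(openin Y V \<and> (\<forall>g\<in>carrier G. \<psi> g ` V \<subseteq> V) \<and>
        (\<exists>s. G_map G (subtopology Y V) \<psi> X \<phi> s \<and>
             G_homotopic G (subtopology Y V) \<psi> Y \<psi> (q \<circ> s) (\<lambda>y. y))) \<longleftrightarrow>
      (openin Y V \<and> (\<exists>s. continuous_map (subtopology Y V) X s \<and>
             homotopic_with (\<lambda>_. True) (subtopology Y V) Y (q \<circ> s) (\<lambda>y. y)))"
    (is "_ \<longleftrightarrow> ?R") for V :: "'b set"
  proof
    assume R: ?R
    then have V: "V \<subseteq> topspace Y" using openin_subset by blast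
    have "\<psi> g ` V \<subseteq> V" if "g \<in> carrier G" for g
      using that V Y by (auto simp: trivial_action_def)
    moreover have "equivariant_on G (topspace (subtopology Y V)) \<psi> \<phi> s"
      if "continuous_map (subtopology Y V) X s" for s
      by (rule equivariant_on_trivial_action[OF Y X])
         (use continuous_map_image_subset_topspace[OF that] in auto)
    moreover have "equivariant_on G (topspace (subtopology Y V)) \<psi> \<psi> f"
      if "continuous_map (subtopology Y V) Y f" for f
      by (rule equivariant_on_trivial_action[OF Y Y])
         (use continuous_map_image_subset_topspace[OF that] in auto)
    ultimately show "openin Y V \<and> (\<forall>g\<in>carrier G. \<psi> g ` V \<subseteq> V) \<and>
        (\<exists>s. G_map G (subtopology Y V) \<psi> X \<phi> s \<and>
             G_homotopic G (subtopology Y V) \<psi> Y \<psi> (q \<circ> s) (\<lambda>y. y))"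
      using R unfolding G_map_def G_homotopic_def by (metis (no_types, lifting) homotopic_with_mono)
  next
    assume L: "openin Y V \<and> (\<forall>g\<in>carrier G. \<psi> g ` V \<subseteq> V) \<and>
        (\<exists>s. G_map G (subtopology Y V) \<psi> X \<phi> s \<and>
             G_homotopic G (subtopology Y V) \<psi> Y \<psi> (q \<circ> s) (\<lambda>y. y))"
    then show ?R
      unfolding G_map_def G_homotopic_def by (metis (no_types, lifting) homotopic_with_mono)
  qed
  show ?thesis
    unfolding secat_def eq ..
qed

lemma fibre_product_mod_trivial_action:
  assumes G: "group G" and B: "trivial_action G B \<psi>" and p: "continuous_map E B p"
  shows "fibre_product_mod G E \<psi> p = subtopology (prod_topology E E) {(e1, e2). p e1 = p e2}"
proof -
  have "orbit G \<psi> (p e) = {p e}" if "e \<in> topspace E" for e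
    using that continuous_map_image_subset_topspace[OF p] by (intro orbit_trivial_action[OF G B]) auto
  then show ?thesis
    unfolding fibre_product_mod_def by (intro subtopology_eqI) auto
qed

lemma composable_mod_trivial_action:
  assumes G: "group G" and E: "trivial_action G E \<phi>"
    and P: "topspace P \<subseteq> topspace (path_space E)"
  shows "composable_mod G \<phi> P = subtopology (prod_topology P P) {(\<gamma>, \<delta>). \<gamma> 1 = \<delta> 0}"
proof -
  have "orbit G \<phi> (\<gamma> t) = {\<gamma> t}" if "\<gamma> \<in> topspace P" "t \<in> {0..1}" for \<gamma> t
    using orbit_trivial_action[OF G E] path_in_topspace[of \<gamma> E t] that P by blast
  then show ?thesis
    unfolding composable_mod_def by (intro subtopology_eqI) auto
qed

lemma topspace_fibre_path_space_subset:
  "topspace (fibre_path_space E B p) \<subseteq> topspace (path_space E)"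
  by (auto simp: fibre_path_space_def)


section \<open>Comparison of the topological complexities\<close>

text \<open>Lifting homotopies makes a section up to homotopy strict. The test space is \<open>I \<times> U\<close>,
  which explains the type of \<open>Z\<close>.\<close>

lemma section_iff_homotopy_section:
  fixes E :: "'e topology" and B :: "'b topology"
  assumes p: "continuous_map E B p"
    and lift: "\<And>Z :: (real \<times> 'e \<times> 'e) topology. Hausdorff_space Z \<Longrightarrow> has_homotopy_lifting E B p Z"
    and E: "Hausdorff_space E"
    and Y: "Y = subtopology (prod_topology E E) {(e1, e2). p e1 = p e2}"
    and X: "X = subtopology (prod_topology (fibre_path_space E B p) (fibre_path_space E B p))
                  {(\<gamma>, \<delta>). \<gamma> 1 = \<delta> 0}"
    and U: "U \<subseteq> topspace Y"
  shows "(\<exists>s. continuous_map (subtopology Y U) X s \<and>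
            homotopic_with (\<lambda>_. True) (subtopology Y U) Y (endpoints \<circ> s) (\<lambda>y. y)) \<longleftrightarrow>
         (\<exists>\<sigma>. continuous_map (subtopology Y U) (fibre_path_space E B p) \<sigma> \<and>
            (\<forall>y\<in>U. (\<sigma> y 0, \<sigma> y 1) = y))"
    (is "?homotopy_section \<longleftrightarrow> ?section")
proof
  let ?W = "subtopology Y U" and ?P = "fibre_path_space E B p"
  have W: "topspace ?W = U" using U by auto
  assume ?homotopy_section
  then obtain s H where s: "continuous_map ?W X s"
    and H: "continuous_map (prod_topology unit_interval ?W) Y H"
    and H0: "\<And>y. H (0, y) = endpoints (s y)" and H1: "\<And>y. H (1, y) = y"
    unfolding homotopic_with_def by auto
  have s2: "continuous_map ?W ?P (\<lambda>y. fst (s y))" "continuous_map ?W ?P (\<lambda>y. snd (s y))"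
      "\<And>y. y \<in> U \<Longrightarrow> fst (s y) 1 = snd (s y) 0"
    using s W unfolding X continuous_map_in_subtopology continuous_map_pairwise
    by (auto simp: o_def Pi_iff case_prod_unfold)
  have H2: "continuous_map (prod_topology unit_interval ?W) E (\<lambda>z. fst (H z))"
      "continuous_map (prod_topology unit_interval ?W) E (\<lambda>z. snd (H z))"
      "\<And>t y. t \<in> {0..1} \<Longrightarrow> y \<in> U \<Longrightarrow> p (fst (H (t, y))) = p (snd (H (t, y)))"
    using H W unfolding Y continuous_map_in_subtopology continuous_map_pairwise
    by (auto simp: o_def Pi_iff case_prod_unfold)
  have "has_homotopy_lifting E B p (prod_topology unit_interval ?W)"
    by (intro lift) (simp add: Y E Hausdorff_space_prod_topology Hausdorff_space_subtopology)
  then obtain \<sigma> where "continuous_map ?W ?P \<sigma>"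
      "\<And>y. y \<in> topspace ?W \<Longrightarrow> \<sigma> y 0 = fst (H (1, y)) \<and> \<sigma> y 1 = snd (H (1, y))"
    by (rule vertical_paths_transport[OF p _ s2(1,2) _ H2(1,2)])
       (use W s2(3) H2(3) H0 in \<open>auto simp: endpoints_def case_prod_unfold\<close>)
  then have "continuous_map ?W ?P \<sigma> \<and> (\<forall>y\<in>U. (\<sigma> y 0, \<sigma> y 1) = y)"
    unfolding W H1 by simp
  then show ?section by blast
next
  let ?W = "subtopology Y U" and ?P = "fibre_path_space E B p"
  have W: "topspace ?W = U" using U by auto
  assume ?section
  then obtain \<sigma> where \<sigma>: "continuous_map ?W ?P \<sigma>" and ends: "\<And>y. y \<in> U \<Longrightarrow> (\<sigma> y 0, \<sigma> y 1) = y"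
    by blast
  \<comment> \<open>The second path has to start at \<open>\<sigma> y 1 = snd y\<close> and to end at \<open>snd y\<close>.\<close>
  define s where "s y = (\<sigma> y, \<lambda>t\<in>{0..1::real}. snd y)" for y
  have "continuous_map ?W E snd"
    unfolding Y by (intro continuous_map_from_subtopology continuous_map_snd)
  then have "continuous_map (prod_topology unit_interval ?W) E (\<lambda>z. snd (snd z))"
    using continuous_map_compose[OF continuous_map_snd] by (fastforce simp: o_def)
  from continuous_map_into_fibre_path_space[OF p this, of "\<lambda>y. p (snd y)"]
  have "continuous_map ?W ?P (\<lambda>y. \<lambda>t\<in>{0..1}. snd y)" by simp
  moreover have "\<sigma> y 1 = snd y" if "y \<in> U" for y using ends[OF that] by (metis snd_conv)
  ultimately have s: "continuous_map ?W X s"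
    unfolding X s_def using \<sigma> W
    by (intro continuous_map_into_subtopology continuous_map_pairedI) auto
  have "(endpoints \<circ> s) y = y" if "y \<in> U" for y
    using ends[OF that] by (auto simp: endpoints_def s_def prod_eq_iff)
  moreover have id: "continuous_map ?W Y (\<lambda>y. y)"
    using continuous_map_from_subtopology[OF continuous_map_id] by (simp add: id_def)
  ultimately have "homotopic_with (\<lambda>_. True) ?W Y (endpoints \<circ> s) (\<lambda>y. y)"
    using W by (intro homotopic_with_equal continuous_map_eq[OF id]) auto
  then show ?homotopy_section using s by blast
qed

theorem invariant_param_TC_trivial_action:
  assumes G: "topological_group G T" and fib: "G_fibration G T E \<phi> B \<psi> p"
    and triv: "trivial_action G E \<phi>" "trivial_action G B \<psi>"
  shows "invariant_param_TC G E \<phi> B \<psi> p = param_TC E B p"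
proof -
  have grp: "group G" and E: "Hausdorff_space E" and p: "continuous_map E B p"
    using G fib by (auto simp: topological_group_def G_fibration_def G_space_def G_map_def)
  let ?P = "fibre_path_space E B p"
  define X where "X = composable_mod G \<phi> ?P"
  define Y where "Y = fibre_product_mod G E \<psi> p"
  have X_eq: "X = subtopology (prod_topology ?P ?P) {(\<gamma>, \<delta>). \<gamma> 1 = \<delta> 0}"
    unfolding X_def
    by (rule composable_mod_trivial_action[OF grp triv(1) topspace_fibre_path_space_subset])
  have Y_eq: "Y = subtopology (prod_topology E E) {(e1, e2). p e1 = p e2}"
    unfolding Y_def by (rule fibre_product_mod_trivial_action[OF grp triv(2) p])
  have "topspace X \<subseteq> topspace (path_space E) \<times> topspace (path_space E)"
    using topspace_fibre_path_space_subset[of E B p] by (auto simp: X_eq)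
  then have tX: "trivial_action (G \<times>\<times> G) X (prod_action (topspace X) (path_action \<phi>) (path_action \<phi>))"
    using trivial_action_path_action[OF triv(1)] by (intro trivial_action_prod_action)
  have tY: "trivial_action (G \<times>\<times> G) Y (prod_action (topspace Y) \<phi> \<phi>)"
    by (intro trivial_action_prod_action[OF triv(1) triv(1)]) (auto simp: Y_eq)
  have "(openin Y V \<and> (\<exists>s. continuous_map (subtopology Y V) X s \<and>
           homotopic_with (\<lambda>_. True) (subtopology Y V) Y (endpoints \<circ> s) (\<lambda>y. y))) \<longleftrightarrow>
       (openin Y V \<and> (\<exists>s. continuous_map (subtopology Y V) ?P s \<and> (\<forall>y\<in>V. (s y 0, s y 1) = y)))"
    for V
  proof (rule conj_cong[OF refl])
    assume "openin Y V"
    then show "(\<exists>s. continuous_map (subtopology Y V) X s \<and>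
           homotopic_with (\<lambda>_. True) (subtopology Y V) Y (endpoints \<circ> s) (\<lambda>y. y)) \<longleftrightarrow>
       (\<exists>s. continuous_map (subtopology Y V) ?P s \<and> (\<forall>y\<in>V. (s y 0, s y 1) = y))"
      by (intro section_iff_homotopy_section[OF p _ E Y_eq X_eq]
          G_fibration_trivial_action_lifting[OF G fib triv] openin_subset)
  qed
  then show ?thesis
    unfolding invariant_param_TC_def param_TC_def Let_def X_def[symmetric] Y_def[symmetric]
      secat_trivial_action[OF tX tY] Y_eq[symmetric] by simp
qed

theorem invariant_param_TC_over_point:
  assumes p: "continuous_map E B p" and B: "topspace B = {b}"
  shows "invariant_param_TC G E \<phi> B \<psi> p = invariant_TC G E \<phi>"
proof -
  have pb: "p e = b" if "e \<in> topspace E" for e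
    using continuous_map_image_subset_topspace[OF p] B that by auto
  have "fibre_path_space E B p = path_space E"
    unfolding fibre_path_space_def B
    by (rule subtopology_superset) (use pb path_in_topspace[of _ E] in auto)
  moreover have "fibre_product_mod G E \<psi> p = prod_topology E E"
    unfolding fibre_product_mod_def by (rule subtopology_superset) (auto simp: pb)
  ultimately show ?thesis
    by (simp add: invariant_param_TC_def invariant_TC_def)
qed

theorem proposition4p4:
  fixes G :: "('g, 'm) monoid_scheme" and T :: "'g topology"
    and E :: "'e topology" and \<phi> :: "'g \<Rightarrow> 'e \<Rightarrow> 'e"
    and B :: "'b topology" and \<psi> :: "'g \<Rightarrow> 'b \<Rightarrow> 'b"
    and p :: "'e \<Rightarrow> 'b"
  assumes "topological_group G T"
    and "G_fibration G T E \<phi> B \<psi> p"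
  shows "(trivial_action G E \<phi> \<and> trivial_action G B \<psi> \<longrightarrow>
            invariant_param_TC G E \<phi> B \<psi> p = param_TC E B p) \<and>
         ((\<exists>b. topspace B = {b}) \<longrightarrow>
            invariant_param_TC G E \<phi> B \<psi> p = invariant_TC G E \<phi>)"
proof (intro conjI impI)
  assume "trivial_action G E \<phi> \<and> trivial_action G B \<psi>"
  then show "invariant_param_TC G E \<phi> B \<psi> p = param_TC E B p"
    using invariant_param_TC_trivial_action[OF assms] by blast
next
  assume "\<exists>b. topspace B = {b}"
  then obtain b where "topspace B = {b}" ..
  moreover have "continuous_map E B p"
    using assms(2) by (simp add: G_fibration_def G_map_def)
  ultimately show "invariant_param_TC G E \<phi> B \<psi> p = invariant_TC G E \<phi>"
    by (intro invariant_param_TC_over_point)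
qed

end
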